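(* Let $k$ be a field and let $D$ be a division algebra over $k$. If $\mathrm{Ld}^*(D)<1$ then $\mathrm{Ld}^*(D)=0$; moreover, $\mathrm{Ld}^*(D)=0$ if and only if every finitely generated $k$-subalgebra of $D$ is finite-dimensional as a $k$-vector space.
   Context: A subframe of a $k$-algebra $A$ is a finite-dimensional $k$-subspace of $A$ containing $1$. For a $k$-algebra $A$ that is a domain and a subframe $V$ of $A$, $\mathrm{VDI}^*(V)\in[0,\infty]$ is the supremum of all real $d>0$ for which there is a constant $C>0$ with $\max(\dim_k(VW),\dim_k(WV))\ge \dim_k(W)+C\,(\dim_k W)^{(d-1)/d}$ for every subframe $W$ of $A$ (and $0$ if there is no such $d$). The strong lower transcendence degree is $\mathrm{Ld}^*(A)=\sup_V\mathrm{VDI}^*(V)$ over all subframes $V$ of $A$. Here $VW$ is the $k$-span of the products $vw$. *)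

theory Defs
  imports Complex_Main "HOL-Library.Extended_Nonnegative_Real"
begin

text \<open>Associative unital algebras over a field, with the scalar multiplication as parameter.\<close>

locale k_algebra = vector_space scale
  for scale :: "'k::field \<Rightarrow> 'a::ring_1 \<Rightarrow> 'a" (infixr "*s" 75) +
  assumes scale_mult_left: "(c *s x) * y = c *s (x * y)"
    and scale_mult_right: "x * (c *s y) = c *s (x * y)"
begin

definition finite_dim :: "'a set \<Rightarrow> bool" where
  "finite_dim W \<longleftrightarrow> (\<exists>B. finite B \<and> span B = W)"

definition subframe :: "'a set \<Rightarrow> bool" where
  "subframe V \<longleftrightarrow> subspace V \<and> finite_dim V \<and> 1 \<in> V"

definition set_prod :: "'a set \<Rightarrow> 'a set \<Rightarrow> 'a set" where
  "set_prod V W = span {v * w |v w. v \<in> V \<and> w \<in> W}"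

definition subalgebra :: "'a set \<Rightarrow> bool" where
  "subalgebra A \<longleftrightarrow> subspace A \<and> 1 \<in> A \<and> (\<forall>x\<in>A. \<forall>y\<in>A. x * y \<in> A)"

definition fin_gen_subalgebra :: "'a set \<Rightarrow> bool" where
  "fin_gen_subalgebra A \<longleftrightarrow> (\<exists>S. finite S \<and> A = subalgebra hull S)"

end

locale k_domain = k_algebra scale
  for scale :: "'k::field \<Rightarrow> 'a::ring_1_no_zero_divisors \<Rightarrow> 'a" (infixr "*s" 75)
begin

text \<open>Suprema are taken in \<^typ>\<open>ennreal\<close>, where the supremum of the empty set is \<open>0\<close>.\<close>

definition VDI_star :: "'a set \<Rightarrow> ennreal" where
  "VDI_star V =
    (SUP d\<in>{d::real. d > 0 \<and>
        (\<exists>C::real. C > 0 \<and> (\<forall>W. subframe W \<longrightarrow>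
          real (max (dim (set_prod V W)) (dim (set_prod W V)))
            \<ge> real (dim W) + C * real (dim W) powr ((d - 1) / d)))}.
      ennreal d)"

definition Ld_star :: ennreal where
  "Ld_star = (SUP V\<in>{V. subframe V}. VDI_star V)"

end

locale division_algebra = k_domain scale
  for scale :: "'k::field \<Rightarrow> 'a::division_ring \<Rightarrow> 'a" (infixr "*s" 75)

end

theory Submission
  imports Defs
begin

text \<open>
  Everything rests on one dichotomy for a subframe \<open>V\<close>, according to whether the subalgebra that it
  generates is finite-dimensional. If it is, then this subalgebra is itself a subframe \<open>W\<close> with
  \<open>VW = WV = W\<close>, so no growth inequality with a positive constant can hold for \<open>V\<close>, whatever the
  exponent (\<open>VDI_star_eq_0\<close>). If it is not, then \<open>VW = W\<close> is impossible for every subframe \<open>W\<close>: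
  such a \<open>W\<close> would be stable under left multiplication by the whole generated subalgebra, hence,
  as \<open>1 \<in> W\<close>, would contain it. Since \<open>W \<subseteq> VW\<close>, multiplication by \<open>V\<close> raises the dimension by
  at least one, and this is the growth inequality with \<open>d = 1\<close> and \<open>C = 1\<close> (\<open>VDI_star_ge_1\<close>).

  Hence \<open>Ld_star\<close> vanishes when all finitely generated subalgebras are finite-dimensional, and is at
  least \<open>1\<close> otherwise. Both parts of the proposition follow.
\<close>

context k_algebra
begin

lemma subalgebra_hull: "subalgebra (subalgebra hull S)"
proof (rule hull_in)
  fix T :: "'a set set"
  assume "Ball T subalgebra"
  then show "subalgebra (\<Inter>T)"
    unfolding subalgebra_def by (simp add: subspace_Inter)
qed

lemma finite_dim_subset:
  assumes "finite_dim W" "subspace U" "U \<subseteq> W"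
  shows "finite_dim U"
proof -
  obtain B where B: "finite B" "span B = W"
    using assms(1) unfolding finite_dim_def by blast
  obtain C where C: "C \<subseteq> U" "independent C" "U \<subseteq> span C"
    by (rule basis_exists[of U])
  then have "finite C"
    using independent_span_bound[OF B(1) C(2)] assms(3) B(2) by blast
  moreover have "span C = U"
    using C assms(2) by (simp add: span_minimal subset_antisym)
  ultimately show ?thesis
    unfolding finite_dim_def by blast
qed

lemma dim_less:
  assumes "finite_dim W" "subspace U" "U \<subset> W"
  shows "dim U < dim W"
proof -
  obtain C where C: "C \<subseteq> U" "independent C" "U \<subseteq> span C" "card C = dim U"
    by (rule basis_exists[of U])
  obtain D where D: "C \<subseteq> D" "D \<subseteq> W" "independent D" "W \<subseteq> span D"
    using maximal_independent_subset_extend[of C W] C assms(3) by blast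
  obtain B where B: "finite B" "span B = W"
    using assms(1) unfolding finite_dim_def by blast
  have "finite D"
    using independent_span_bound[OF B(1) D(3)] D(2) B(2) by blast
  moreover have "C \<noteq> D"
    using C(1) D(4) assms(2,3) span_minimal[of C U] by blast
  ultimately have "card C < card D"
    using D(1) by (simp add: psubset_card_mono psubsetI)
  also have "card D = dim W"
    using D by (intro basis_card_eq_dim) auto
  finally show ?thesis
    using C(4) by simp
qed

lemma mult_mem_span_products:
  assumes "v \<in> span B" "w \<in> span C"
  shows "v * w \<in> span {b * c |b c. b \<in> B \<and> c \<in> C}" (is "_ \<in> span ?P")
proof -
  have left: "b * w \<in> span ?P" if "b \<in> B" for b
    using assms(2)
  proof (induction rule: span_induct_alt)
    case base
    then show ?case by (simp add: span_zero)
  next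
    case (step c x y)
    moreover have "b * x \<in> span ?P"
      using that step(1) by (intro span_base) blast
    ultimately show ?case
      by (simp add: distrib_left scale_mult_right span_add span_scale)
  qed
  show ?thesis
    using assms(1)
  proof (induction rule: span_induct_alt)
    case base
    then show ?case by (simp add: span_zero)
  next
    case (step c x y)
    then show ?case
      using left[of x] by (simp add: distrib_right scale_mult_left span_add span_scale)
  qed
qed

lemma finite_dim_set_prod:
  assumes "finite_dim V" "finite_dim W"
  shows "finite_dim (set_prod V W)"
proof -
  obtain B C where B: "finite B" "span B = V" and C: "finite C" "span C = W"
    using assms unfolding finite_dim_def by blast
  let ?P = "{b * c |b c. b \<in> B \<and> c \<in> C}"
  have "finite ?P"
    using B(1) C(1) by (rule finite_image_set2[of "\<lambda>b. b \<in> B" "\<lambda>c. c \<in> C", simplified])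
  moreover have "span ?P = set_prod V W"
    unfolding set_prod_def
  proof (rule subset_antisym)
    show "span ?P \<subseteq> span {v * w |v w. v \<in> V \<and> w \<in> W}"
      using B(2) C(2) by (intro span_mono) (blast intro: span_base)
    show "span {v * w |v w. v \<in> V \<and> w \<in> W} \<subseteq> span ?P"
      using B(2) C(2) by (intro span_minimal) (auto intro: mult_mem_span_products)
  qed
  ultimately show ?thesis
    unfolding finite_dim_def by blast
qed

lemma mult_mem_set_prod: "v \<in> V \<Longrightarrow> w \<in> W \<Longrightarrow> v * w \<in> set_prod V W"
  unfolding set_prod_def by (rule span_base) blast

lemma subset_set_prod_left: "1 \<in> V \<Longrightarrow> W \<subseteq> set_prod V W"
  using mult_mem_set_prod[of 1 V _ W] by auto

lemma subset_set_prod_right: "1 \<in> V \<Longrightarrow> W \<subseteq> set_prod W V"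
  using mult_mem_set_prod[of _ W 1 V] by auto

lemma set_prod_subalgebra:
  assumes "subalgebra A" "V \<subseteq> A" "1 \<in> V"
  shows "set_prod V A = A" "set_prod A V = A"
proof -
  have "{v * w |v w. v \<in> V \<and> w \<in> A} \<subseteq> A" "{v * w |v w. v \<in> A \<and> w \<in> V} \<subseteq> A"
    using assms(1,2) unfolding subalgebra_def by blast+
  then have "set_prod V A \<subseteq> A" "set_prod A V \<subseteq> A"
    using assms(1) unfolding set_prod_def subalgebra_def by (simp_all add: span_minimal)
  then show "set_prod V A = A" "set_prod A V = A"
    using subset_set_prod_left subset_set_prod_right assms(3) by blast+
qed

text \<open>The left multipliers that preserve \<open>W\<close> form a subalgebra; since \<open>1 \<in> W\<close>, each of them is its
  own value at \<open>1\<close> and so lies in \<open>W\<close>.\<close>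

lemma generated_subalgebra_subset_stable:
  assumes "subspace W" "1 \<in> W" "\<And>s w. s \<in> S \<Longrightarrow> w \<in> W \<Longrightarrow> s * w \<in> W"
  shows "subalgebra hull S \<subseteq> W"
proof -
  let ?L = "{a. \<forall>w\<in>W. a * w \<in> W}"
  have "subalgebra ?L"
    using assms(1) unfolding subalgebra_def subspace_def
    by (auto simp: distrib_right scale_mult_left mult.assoc)
  then have "subalgebra hull S \<subseteq> ?L"
    using assms(3) by (intro hull_minimal) auto
  then show ?thesis
    using assms(2) by fastforce
qed

text \<open>As \<open>1 \<in> V\<close> gives \<open>W \<subseteq> VW\<close>, equality of dimensions would mean \<open>VW = W\<close>; then \<open>W\<close> would be
  stable under \<open>S\<close> and contain the infinite-dimensional subalgebra that \<open>S\<close> generates.\<close>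

lemma dim_less_dim_set_prod:
  assumes V: "subframe V" and W: "subframe W"
    and "S \<subseteq> V" "\<not> finite_dim (subalgebra hull S)"
  shows "dim W < dim (set_prod V W)"
proof (rule dim_less)
  show "finite_dim (set_prod V W)"
    using V W by (simp add: subframe_def finite_dim_set_prod)
  show "subspace W"
    using W by (simp add: subframe_def)
  have "set_prod V W \<noteq> W"
  proof
    assume eq: "set_prod V W = W"
    have "subalgebra hull S \<subseteq> W"
    proof (rule generated_subalgebra_subset_stable)
      fix s w assume "s \<in> S" "w \<in> W"
      then show "s * w \<in> W"
        using mult_mem_set_prod[of s V w W] \<open>S \<subseteq> V\<close> eq by blast
    qed (use W in \<open>auto simp: subframe_def\<close>)
    then have "finite_dim (subalgebra hull S)"
      using W subalgebra_hull[of S] finite_dim_subset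
      by (auto simp: subframe_def subalgebra_def)
    then show False
      using assms(4) by contradiction
  qed
  then show "W \<subset> set_prod V W"
    using subset_set_prod_left[of V W] V by (auto simp: subframe_def)
qed

lemma dim_pos:
  assumes "subframe W"
  shows "0 < dim W"
proof -
  have "dim {0} < dim W"
    using assms
    by (intro dim_less) (auto simp: subframe_def subspace_single_0 subspace_0)
  then show ?thesis by simp
qed

end

context k_domain
begin

lemma VDI_star_eq_0:
  assumes "subframe V" "V \<subseteq> A" "subalgebra A" "finite_dim A"
  shows "VDI_star V = 0"
proof -
  have A: "subframe A"
    using assms(3,4) by (simp add: subframe_def subalgebra_def)
  have prods: "set_prod V A = A" "set_prod A V = A"
    using set_prod_subalgebra assms by (auto simp: subframe_def)
  have "\<not> real (max (dim (set_prod V A)) (dim (set_prod A V)))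
          \<ge> real (dim A) + C * real (dim A) powr ((d - 1) / d)" if "C > 0" for C d :: real
    using prods dim_pos[OF A] that by (simp add: mult_le_0_iff)
  then have "{d::real. d > 0 \<and>
        (\<exists>C::real. C > 0 \<and> (\<forall>W. subframe W \<longrightarrow>
          real (max (dim (set_prod V W)) (dim (set_prod W V)))
            \<ge> real (dim W) + C * real (dim W) powr ((d - 1) / d)))} = {}"
    using A by blast
  then show ?thesis
    unfolding VDI_star_def by (simp only: image_empty Sup_empty bot_ennreal)
qed

lemma VDI_star_ge_1:
  assumes "subframe V" "S \<subseteq> V" "\<not> finite_dim (subalgebra hull S)"
  shows "1 \<le> VDI_star V"
proof -
  have "real (dim W) + 1 \<le> real (max (dim (set_prod V W)) (dim (set_prod W V)))"
    if "subframe W" for W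
    using dim_less_dim_set_prod[OF assms(1) that assms(2,3)] by simp
  then have "real (dim W) + 1 * real (dim W) powr ((1 - 1) / 1)
      \<le> real (max (dim (set_prod V W)) (dim (set_prod W V)))" if "subframe W" for W
    using that dim_pos[OF that] by simp
  then have "ennreal 1 \<le> VDI_star V"
    unfolding VDI_star_def
    by (intro SUP_upper CollectI conjI exI[of _ 1] allI impI) simp_all
  then show ?thesis by simp
qed

lemma Ld_star_eq_0:
  assumes "\<And>A. fin_gen_subalgebra A \<Longrightarrow> finite_dim A"
  shows "Ld_star = 0"
proof -
  have "VDI_star V = 0" if V: "subframe V" for V
  proof -
    obtain B where B: "finite B" "span B = V"
      using V unfolding subframe_def finite_dim_def by blast
    let ?A = "subalgebra hull B"
    have "V \<subseteq> ?A"
      using B(2) span_minimal[OF hull_subset] subalgebra_hull[of B]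
      by (auto simp: subalgebra_def)
    moreover have "finite_dim ?A"
      using assms B(1) unfolding fin_gen_subalgebra_def by blast
    ultimately show ?thesis
      using VDI_star_eq_0[OF V] subalgebra_hull by blast
  qed
  then have "Ld_star \<le> 0"
    unfolding Ld_star_def by (intro SUP_least) simp
  then show ?thesis by simp
qed

lemma Ld_star_ge_1:
  assumes "fin_gen_subalgebra A" "\<not> finite_dim A"
  shows "1 \<le> Ld_star"
proof -
  obtain S where S: "finite S" "A = subalgebra hull S"
    using assms(1) unfolding fin_gen_subalgebra_def by blast
  let ?V = "span (insert 1 S)"
  have V: "subframe ?V"
    using S(1) unfolding subframe_def finite_dim_def
    by (auto intro: span_base)
  have "1 \<le> VDI_star ?V"
    using VDI_star_ge_1[OF V] assms(2) S(2) span_superset[of "insert 1 S"] by blast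
  also have "\<dots> \<le> Ld_star"
    unfolding Ld_star_def using V by (intro SUP_upper) simp
  finally show ?thesis .
qed

end

theorem proposition3p4:
  fixes scale :: "'k::field \<Rightarrow> 'd::division_ring \<Rightarrow> 'd"
  assumes "division_algebra scale"
  shows "(k_domain.Ld_star scale < 1 \<longrightarrow> k_domain.Ld_star scale = 0) \<and>
    (k_domain.Ld_star scale = 0 \<longleftrightarrow>
      (\<forall>A. k_algebra.fin_gen_subalgebra scale A \<longrightarrow> k_algebra.finite_dim scale A))"
proof -
  interpret division_algebra scale by (rule assms)
  show ?thesis
    using Ld_star_eq_0 Ld_star_ge_1 by (metis leD not_one_le_zero)
qed

end
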